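(* Let $p$ be a prime, let $U\subseteq\{0,1,\ldots,p-1\}$, let $a$ be uniformly random in $\{1,\ldots,p-1\}$ and $t$ uniformly random in $\{0,\ldots,p-1\}$, independent of $a$. Define $\mathit{Sample}:U\to\{0,1\}$ by $\mathit{Sample}(x)=1$ if $(ax\bmod p)\le t$ and $0$ otherwise. Then $\mathit{Sample}$ is a distinguisher with probability $1/8$: for every commutative monoid $R$ and every function $v:U\to R$ with $v(x)\ne 0$ for at least one $x\in U$, \[\Pr_{a,t}\Big[\sum\{v(x)\mid x\in U,\ \mathit{Sample}(x)=1\}\neq 0\Big]\ \ge\ 1/8.\]
   Context: A commutative monoid is a set with a commutative, associative addition having a neutral element $0$. The sum is taken in $R$ over the sampled keys (empty sum is $0$). *)

theory Defs
  imports "HOL-Probability.Probability"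
begin

definition sample :: "nat \<Rightarrow> nat \<Rightarrow> nat \<Rightarrow> nat \<Rightarrow> nat" where
  "sample p a t x = (if (a * x) mod p \<le> t then 1 else 0)"

definition sample_seed :: "nat \<Rightarrow> (nat \<times> nat) pmf" where
  "sample_seed p = pair_pmf (pmf_of_set {1..p - 1}) (pmf_of_set {0..p - 1})"

end

theory Submission
  imports Defs "HOL-Number_Theory.Cong"
begin

text \<open>
  Let \<open>A\<close> be the support of \<open>v\<close> in \<open>U\<close>, \<open>n\<close> its size, and place each key \<open>x\<close> at the point
  \<open>a x mod p\<close>. For fixed \<open>a\<close>, adding one nonzero value to a zero sum gives a nonzero sum, so of
  any two consecutive points at least one has a nonzero prefix sum, as does the first point; hence
  at least \<open>n/2\<close> points start a gap on which the sampled sum is nonzero. Gaps are rarely short: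
  for fixed distinct \<open>x\<close>, \<open>x'\<close> and \<open>d\<close>, at most one \<open>a\<close> places \<open>x'\<close> at distance \<open>d\<close> after \<open>x\<close>, and
  treating \<open>p\<close> as an additional endpoint gives exactly \<open>n\<^sup>2\<close> pairs \<open>(x, x')\<close>. Counting only the first
  \<open>K + 1\<close> thresholds of each gap with \<open>K = (p - 1) div (2n)\<close>, at least
  \<open>n (K + 1) (p - 1 - n K) / 2 \<ge> p (p - 1) / 8\<close> of the pairs \<open>(a, t)\<close> have a nonzero sum.
\<close>

section \<open>Prefix sums and thresholds for a fixed multiplier\<close>

text \<open>The least point has its own nonzero value as prefix sum. So every point with zero prefix
  sum has an immediate predecessor, and sending it there injects the zero points into the nonzero
  ones.\<close>

lemma card_nonzero_prefix_sums:
  fixes h :: "'a \<Rightarrow> 'b::linorder" and v :: "'a \<Rightarrow> 'r::comm_monoid_add"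
  assumes fin: "finite A" and inj: "inj_on h A" and nz: "\<And>x. x \<in> A \<Longrightarrow> v x \<noteq> 0"
  shows "card A \<le> 2 * card {x \<in> A. (\<Sum>y | y \<in> A \<and> h y \<le> h x. v y) \<noteq> 0}"
proof -
  define S where "S x = (\<Sum>y | y \<in> A \<and> h y \<le> h x. v y)" for x
  define G where "G = {x \<in> A. S x \<noteq> 0}"
  define B where "B = {x \<in> A. S x = 0}"
  have "\<exists>y\<in>A. h y < h x \<and> (\<forall>z\<in>A. h z < h x \<longrightarrow> h z \<le> h y)" if x: "x \<in> B" for x
  proof -
    define L where "L = {y \<in> A. h y < h x}"
    have "L \<noteq> {}"
    proof
      assume "L = {}"
      then have "{y \<in> A. h y \<le> h x} = {x}"
        using x inj by (fastforce simp: L_def B_def inj_on_def)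
      then show False using x nz by (auto simp: B_def S_def)
    qed
    moreover have "finite L" using fin by (simp add: L_def)
    ultimately have "Max (h ` L) \<in> h ` L" "\<forall>z\<in>L. h z \<le> Max (h ` L)"
      by (auto intro: Max_in)
    then show ?thesis by (auto simp: L_def)
  qed
  then obtain f where f: "\<And>x. x \<in> B \<Longrightarrow> f x \<in> A \<and> h (f x) < h x \<and> (\<forall>z\<in>A. h z < h x \<longrightarrow> h z \<le> h (f x))"
    by metis
  have "f ` B \<subseteq> G"
  proof safe
    fix x assume x: "x \<in> B"
    have "{y \<in> A. h y \<le> h x} = insert x {y \<in> A. h y \<le> h (f x)}"
      using f[OF x] x inj unfolding B_def inj_on_def
      by (auto simp: le_less)
    moreover have "x \<notin> {y \<in> A. h y \<le> h (f x)}" using f[OF x] by auto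
    ultimately have "S x = v x + S (f x)" using fin by (simp add: S_def)
    then show "f x \<in> G" using x f[OF x] nz by (auto simp: G_def B_def)
  qed
  \<comment> \<open>Of two points with a common predecessor, the smaller would be at most that
    predecessor.\<close>
  moreover have "inj_on f B"
  proof (rule inj_onI)
    fix x x' assume *: "x \<in> B" "x' \<in> B" "f x = f x'"
    have "\<not> h x < h x'" "\<not> h x' < h x"
      using f[OF *(1)] f[OF *(2)] * by (auto simp: B_def not_less[symmetric])
    then show "x = x'" using * inj by (auto simp: B_def inj_on_def)
  qed
  moreover have "finite G" using fin by (simp add: G_def)
  ultimately have "card B \<le> card G" by (metis card_inj_on_le)
  moreover have "card A = card G + card B"
    using fin by (subst card_Un_disjoint[symmetric]) (auto simp: G_def B_def intro!: arg_cong[of _ _ card])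
  ultimately show ?thesis by (simp add: G_def S_def)
qed

text \<open>Unless \<open>(x, D)\<close> is exceptional, the threshold \<open>h x + D\<close> is
  below \<open>p\<close> and selects the same keys as \<open>h x\<close>. The exceptional set
  mentions only positions of points, not sums, so it can be counted over all multipliers.\<close>

lemma card_nonzero_thresholds:
  fixes h :: "'a \<Rightarrow> nat" and v :: "'a \<Rightarrow> 'r::comm_monoid_add"
  assumes fin: "finite A" and inj: "inj_on h A" and nz: "\<And>x. x \<in> A \<Longrightarrow> v x \<noteq> 0"
  shows "card A * (K + 1) \<le> 2 * card {t. t < p \<and> (\<Sum>y | y \<in> A \<and> h y \<le> t. v y) \<noteq> 0}
    + 2 * card {(x, D). x \<in> A \<and> D \<le> K \<and> (p \<le> h x + D \<or> (\<exists>x'\<in>A. h x < h x' \<and> h x' \<le> h x + D))}"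
    (is "_ \<le> 2 * card ?T + 2 * card ?E")
proof -
  define G where "G = {x \<in> A. (\<Sum>y | y \<in> A \<and> h y \<le> h x. v y) \<noteq> 0}"
  have finE: "finite ?E"
    by (rule finite_subset[of _ "A \<times> {..K}"]) (use fin in auto)
  \<comment> \<open>If two distinct points reached the same threshold, the lower one would have run
    past the higher one and been exceptional.\<close>
  have "inj_on (\<lambda>(x, D). h x + D) (G \<times> {..K} - ?E)"
  proof (rule inj_onI, clarsimp)
    fix x D x' D'
    assume *: "x \<in> G" "x' \<in> G" "h x + D = h x' + D'" "D \<le> K" "D' \<le> K"
      and 1: "x \<in> A \<longrightarrow> \<not> p \<le> h x' + D' \<and> (\<forall>z\<in>A. h x < h z \<longrightarrow> \<not> h z \<le> h x' + D')"
      and 2: "x' \<in> A \<longrightarrow> \<not> p \<le> h x' + D' \<and> (\<forall>z\<in>A. h x' < h z \<longrightarrow> \<not> h z \<le> h x' + D')"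
    have A: "x \<in> A" "x' \<in> A" using * by (auto simp: G_def)
    have "\<not> h x < h x'" using 1 A by auto
    moreover have "\<not> h x' < h x"
    proof
      assume "h x' < h x"
      then have "\<not> h x \<le> h x' + D'" using 2 A by blast
      then show False using * by linarith
    qed
    ultimately have "h x = h x'" by simp
    then show "x = x' \<and> D = D'" using A inj * by (auto simp: inj_on_def)
  qed
  moreover have "(\<lambda>(x, D). h x + D) ` (G \<times> {..K} - ?E) \<subseteq> ?T"
  proof clarsimp
    fix x D assume x: "x \<in> G" "D \<le> K"
      and n: "x \<in> A \<longrightarrow> \<not> p \<le> h x + D \<and> (\<forall>z\<in>A. h x < h z \<longrightarrow> \<not> h z \<le> h x + D)"
    have "x \<in> A" using x by (simp add: G_def)
    then have n: "h x + D < p" "\<And>z. z \<in> A \<Longrightarrow> h z \<le> h x + D \<Longrightarrow> h z \<le> h x"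
      using n by (auto simp: not_le)
    then have "{y \<in> A. h y \<le> h x + D} = {y \<in> A. h y \<le> h x}" by auto
    then show "h x + D < p \<and> (\<Sum>y | y \<in> A \<and> h y \<le> h x + D. v y) \<noteq> 0"
      using x n(1) by (simp add: G_def)
  qed
  ultimately have "card (G \<times> {..K} - ?E) \<le> card ?T"
    by (rule card_inj_on_le) simp
  moreover have "card (G \<times> {..K}) - card ?E \<le> card (G \<times> {..K} - ?E)"
    by (rule diff_card_le_card_Diff[OF finE])
  ultimately have "card G * (K + 1) \<le> card ?T + card ?E"
    by (simp add: card_cartesian_product)
  moreover have "card A * (K + 1) \<le> 2 * card G * (K + 1)"
    unfolding G_def by (intro mult_right_mono card_nonzero_prefix_sums[OF fin inj nz]) auto
  ultimately show ?thesis by simp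
qed

section \<open>Short gaps over all multipliers\<close>

lemma inj_on_mult_mod_prime:
  fixes p a :: nat
  assumes "prime p" "0 < a" "a < p"
  shows "inj_on (\<lambda>x. a * x mod p) {..<p}"
proof (rule inj_onI)
  fix x y assume *: "x \<in> {..<p}" "y \<in> {..<p}" "a * x mod p = a * y mod p"
  have "coprime a p"
    using assms by (metis coprime_commute nat_dvd_not_less prime_imp_coprime)
  then have "[x = y] (mod p)"
    using * by (simp add: cong_def cong_mult_lcancel_nat[unfolded cong_def])
  then show "x = y" using * by (simp add: cong_def)
qed

lemma multiplier_unique:
  fixes p a b x x' d :: nat
  assumes p: "prime p" and ab: "a < p" "b < p" and x: "x < p" "x' \<le> p" "x' \<noteq> x"
    and d: "0 < d" "d < p"
    and a: "[a * x' = a * x + d] (mod p)" and b: "[b * x' = b * x + d] (mod p)"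
  shows "a = b"
proof -
  have da: "int p dvd int a * (int x' - int x) - int d"
    using a by (simp add: cong_int_iff[symmetric] cong_iff_dvd_diff algebra_simps)
  have db: "int p dvd int b * (int x' - int x) - int d"
    using b by (simp add: cong_int_iff[symmetric] cong_iff_dvd_diff algebra_simps)
  have "int p dvd (int a - int b) * (int x' - int x)"
    using dvd_diff[OF da db] by (simp add: algebra_simps)
  then consider "int p dvd int a - int b" | "int p dvd int x' - int x"
    using p by (auto simp: prime_dvd_mult_iff)
  then show ?thesis
  proof cases
    case 1
    then have "[a = b] (mod p)" by (simp add: cong_int_iff[symmetric] cong_iff_dvd_diff)
    then show ?thesis using ab by (simp add: cong_def)
  next
    \<comment> \<open>This case is \<open>x = 0\<close>, \<open>x' = p\<close>, where both
      congruences would force \<open>p\<close> to divide \<open>d\<close>.\<close>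
    case 2
    then have "int p dvd int a * (int x' - int x)" by simp
    then have "int p dvd int d" using da by (metis dvd_diff_commute dvd_diffD1 diff_diff_eq2 dvd_diff_right_iff)
    then show ?thesis using d by (simp add: nat_dvd_not_less)
  qed
qed

text \<open>Each exceptional \<open>(a, x, D)\<close> is charged to an endpoint \<open>x'\<close>
  and a distance \<open>d\<close> in \<open>{1..D}\<close>. By \<open>multiplier_unique\<close> the
  charge together with \<open>x\<close> and \<open>D\<close> recovers \<open>a\<close>, so it
  suffices to count the charges in \<open>W\<close>.\<close>

lemma card_short_gaps:
  fixes p K :: nat
  assumes p: "prime p" and A: "A \<subseteq> {..<p}" and K: "K < p"
  shows "2 * (\<Sum>a\<in>{1..p - 1}. card {(x, D). x \<in> A \<and> D \<le> K \<and> (p \<le> a * x mod p + D \<or>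
      (\<exists>x'\<in>A. a * x mod p < a * x' mod p \<and> a * x' mod p \<le> a * x mod p + D))})
    \<le> card A * card A * (K * (K + 1))"
proof -
  define E where "E a = {(x, D). x \<in> A \<and> D \<le> K \<and> (p \<le> a * x mod p + D \<or>
      (\<exists>x'\<in>A. a * x mod p < a * x' mod p \<and> a * x' mod p \<le> a * x mod p + D))}" for a
  define W where "W = (SIGMA x:A. insert p A - {x}) \<times> (SIGMA D:{..K}. {1..D})"
  have fin: "finite A" using A finite_subset by blast
  have p0: "0 < p" using p prime_gt_0_nat by blast
  have finE: "finite (E a)" for a
    by (rule finite_subset[of _ "A \<times> {..K}"]) (use fin in \<open>auto simp: E_def\<close>)
  have finW: "finite W" using fin by (auto simp: W_def)
  have "\<exists>x' d. x' \<in> insert p A - {x} \<and> d \<in> {1..D} \<and> [a * x' = a * x + d] (mod p)"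
    if E: "(x, D) \<in> E a" for a x D
  proof -
    consider "p \<le> a * x mod p + D"
      | x' where "x' \<in> A" "a * x mod p < a * x' mod p" "a * x' mod p \<le> a * x mod p + D"
      using E by (auto simp: E_def)
    then show ?thesis
    proof cases
      \<comment> \<open>Running past the end is charged to \<open>x' = p\<close>, since
        \<open>a * p\<close> is congruent to 0.\<close>
      case 1
      have "a * x mod p < p" using p0 by simp
      moreover have "[a * x + (p - a * x mod p) = a * p] (mod p)"
      proof -
        have "[a * x + (p - a * x mod p) = a * x mod p + (p - a * x mod p)] (mod p)"
          by (intro cong_add) (auto simp: cong_def)
        also have "a * x mod p + (p - a * x mod p) = p" using \<open>a * x mod p < p\<close> by simp
        finally show ?thesis by (simp add: cong_def)
      qed
      moreover have "x \<noteq> p" using E A by (auto simp: E_def)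
      ultimately show ?thesis using 1
        by (intro exI[of _ p] exI[of _ "p - a * x mod p"]) (auto simp: cong_sym_eq)
    next
      case 2
      have "[a * x + (a * x' mod p - a * x mod p) = a * x'] (mod p)"
      proof -
        have "[a * x + (a * x' mod p - a * x mod p) = a * x mod p + (a * x' mod p - a * x mod p)] (mod p)"
          by (intro cong_add) (auto simp: cong_def)
        also have "a * x mod p + (a * x' mod p - a * x mod p) = a * x' mod p" using 2 by simp
        finally show ?thesis by (simp add: cong_def)
      qed
      then show ?thesis using 2
        by (intro exI[of _ x'] exI[of _ "a * x' mod p - a * x mod p"]) (auto simp: cong_sym_eq)
    qed
  qed
  then have "\<forall>a x D. \<exists>x' d. (x, D) \<in> E a \<longrightarrow>
      x' \<in> insert p A - {x} \<and> d \<in> {1..D} \<and> [a * x' = a * x + d] (mod p)"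
    by blast
  then obtain X d where Xd: "\<And>a x D. (x, D) \<in> E a \<Longrightarrow> X a x D \<in> insert p A - {x} \<and>
      d a x D \<in> {1..D} \<and> [a * X a x D = a * x + d a x D] (mod p)"
    unfolding choice_iff by blast
  let ?f = "\<lambda>(a, x, D). ((x, X a x D), (D, d a x D))"
  have "inj_on ?f (SIGMA a:{1..p - 1}. E a)"
  proof (rule inj_onI, clarsimp)
    fix a b x D
    assume *: "Suc 0 \<le> a" "a \<le> p - Suc 0" "Suc 0 \<le> b" "b \<le> p - Suc 0"
      and E: "(x, D) \<in> E a" "(x, D) \<in> E b"
      and eq: "X a x D = X b x D" "d a x D = d b x D"
    \<comment> \<open>Here \<open>K < p\<close> is what makes the distance smaller than
      \<open>p\<close>.\<close>
    have "D \<le> K" "x < p" using E A by (auto simp: E_def)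
    moreover have "X a x D \<le> p" using Xd[OF E(1)] A by auto
    ultimately show "a = b"
      using Xd[OF E(1)] Xd[OF E(2)] * eq K p0
      by (intro multiplier_unique[OF p, of a b x "X a x D" "d a x D"]) auto
  qed
  moreover have "?f ` (SIGMA a:{1..p - 1}. E a) \<subseteq> W"
    using Xd by (fastforce simp: W_def E_def)
  ultimately have "card (SIGMA a:{1..p - 1}. E a) \<le> card W"
    by (rule card_inj_on_le) (rule finW)
  then have "(\<Sum>a\<in>{1..p - 1}. card (E a)) \<le> card W"
    using finE by simp
  moreover have "2 * card W = card A * card A * (K * (K + 1))"
  proof -
    have "card (insert p A - {x}) = card A" if "x \<in> A" for x
    proof -
      have "p \<notin> A" using A by auto
      then show ?thesis using that fin by (simp add: card_Diff_singleton)
    qed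
    then have "card (SIGMA x:A. insert p A - {x}) = card A * card A"
      using fin by simp
    moreover have "2 * card (SIGMA D:{..K}. {1..D}) = K * (K + 1)"
      using gauss_sum_nat[of K] by (simp add: atMost_atLeast0)
    ultimately show ?thesis by (simp add: W_def card_cartesian_product algebra_simps)
  qed
  ultimately show ?thesis unfolding E_def by linarith
qed

section \<open>Choice of the gap length and the final count\<close>

theorem theorem7:
  fixes p :: nat and U :: "nat set" and v :: "nat \<Rightarrow> 'r :: comm_monoid_add"
  assumes "prime p"
    and "U \<subseteq> {0..p - 1}"
    and "\<exists>x\<in>U. v x \<noteq> 0"
  shows "measure_pmf.prob (sample_seed p)
           {(a, t). (\<Sum>x\<in>{x \<in> U. sample p a t x = 1}. v x) \<noteq> 0} \<ge> 1 / 8"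
proof -
  define A where "A = {x \<in> U. v x \<noteq> 0}"
  define n where "n = card A"
  define q where "q = p - 1"
  \<comment> \<open>This nearly maximizes \<open>(K + 1) * (q - n * K)\<close>, the quantity bounded
    below in the count.\<close>
  define K where "K = q div (2 * n)"
  define T where "T a = {t. t < p \<and> (\<Sum>y | y \<in> A \<and> a * y mod p \<le> t. v y) \<noteq> 0}" for a
  define N where "N = (\<Sum>a\<in>{1..q}. card (T a))"
  let ?E = "\<lambda>a. {(x, D). x \<in> A \<and> D \<le> K \<and> (p \<le> a * x mod p + D \<or>
      (\<exists>x'\<in>A. a * x mod p < a * x' mod p \<and> a * x' mod p \<le> a * x mod p + D))}"
  have p1: "1 < p" using assms(1) prime_gt_1_nat by blast
  have q: "p = q + 1" "0 < q" using p1 by (auto simp: q_def)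
  have finU: "finite U" using assms(2) finite_subset by blast
  have A: "A \<subseteq> {..<p}" using assms(2) p1 by (fastforce simp: A_def)
  have finA: "finite A" using finU by (simp add: A_def)
  have n: "0 < n" using assms(3) finA by (auto simp: n_def A_def card_gt_0_iff)
  have K: "K < p" using q by (simp add: K_def le_imp_less_Suc)

  have "n * (K + 1) \<le> 2 * card (T a) + 2 * card (?E a)" if "a \<in> {1..q}" for a
    unfolding n_def T_def
    by (rule card_nonzero_thresholds[OF finA])
      (use that q A inj_on_subset[OF inj_on_mult_mod_prime[OF assms(1)] A] in \<open>auto simp: A_def\<close>)
  then have "(\<Sum>a\<in>{1..q}. n * (K + 1)) \<le> (\<Sum>a\<in>{1..q}. 2 * card (T a) + 2 * card (?E a))"
    by (rule sum_mono)
  also have "\<dots> = 2 * N + 2 * (\<Sum>a\<in>{1..q}. card (?E a))"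
    by (simp add: N_def sum.distrib sum_distrib_left)
  also have "\<dots> \<le> 2 * N + n * n * (K * (K + 1))"
    using card_short_gaps[OF assms(1) A K] by (simp add: n_def q_def)
  finally have main: "q * (n * (K + 1)) \<le> 2 * N + n * n * (K * (K + 1))" by simp
  have nK: "2 * (n * K) \<le> q" using times_div_less_eq_dividend[of "2 * n" q] by (simp add: K_def mult.assoc)
  \<comment> \<open>The strict bound \<open>q < 2 * n * (K + 1)\<close> gains the one needed to pass
    from \<open>q\<close> to \<open>p\<close>.\<close>
  have nK1: "p \<le> 2 * (n * (K + 1))"
    using dividend_less_times_div[of "2 * n" q] n q by (simp add: K_def algebra_simps)
  have "p * q \<le> (2 * (n * (K + 1))) * (2 * (q - n * K))"
    by (rule mult_mono) (use nK nK1 in auto)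
  also have "\<dots> = 4 * (q * (n * (K + 1)) - n * n * (K * (K + 1)))"
  proof -
    \<comment> \<open>Writing \<open>q\<close> this way keeps the natural-number subtractions from
      truncating.\<close>
    obtain r where "q = n * K + r" using nK by (metis le_add1 le_trans mult_2 le_iff_add)
    then show ?thesis by (simp add: algebra_simps)
  qed
  also have "\<dots> \<le> 8 * N" using main by linarith
  finally have count: "p * q \<le> 8 * N" .

  \<comment> \<open>Keys of value 0 do not affect the sum, so only the support matters.\<close>
  have sums: "(\<Sum>x\<in>{x \<in> U. sample p a t x = 1}. v x) = (\<Sum>y | y \<in> A \<and> a * y mod p \<le> t. v y)" for a t
    by (rule sum.mono_neutral_right) (use finU in \<open>auto simp: A_def sample_def split: if_splits\<close>)
  have seed: "sample_seed p = pmf_of_set ({1..q} \<times> {0..p - 1})"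
    unfolding sample_seed_def q_def
    by (rule pmf_eqI) (use p1 in \<open>auto simp: pmf_pair pmf_of_set card_cartesian_product indicator_def split: prod.splits\<close>)
  have "measure_pmf.prob (sample_seed p) {(a, t). (\<Sum>x\<in>{x \<in> U. sample p a t x = 1}. v x) \<noteq> 0}
      = card (({1..q} \<times> {0..p - 1}) \<inter> {(a, t). (\<Sum>y | y \<in> A \<and> a * y mod p \<le> t. v y) \<noteq> 0})
        / card ({1..q} \<times> {0..p - 1})"
    unfolding sums seed by (rule measure_pmf_of_set) (use q in auto)
  also have "({1..q} \<times> {0..p - 1}) \<inter> {(a, t). (\<Sum>y | y \<in> A \<and> a * y mod p \<le> t. v y) \<noteq> 0}
      = (SIGMA a:{1..q}. T a)"
    using p1 by (auto simp: T_def)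
  also have "card (SIGMA a:{1..q}. T a) = N"
    by (simp add: N_def T_def)
  also have "card ({1..q} \<times> {0..p - 1}) = p * q"
    using q by (simp add: card_cartesian_product)
  also have "1 / 8 \<le> real N / real (p * q)"
  proof -
    have "real (p * q) \<le> 8 * real N" using count by (metis of_nat_le_iff of_nat_mult of_nat_numeral)
    moreover have "0 < real (p * q)" using p1 q(2) by simp
    ultimately show ?thesis by (simp add: field_simps)
  qed
  finally show ?thesis .
qed

end
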